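(* If $G$ is a full DAG, then $G$ admits an ample framing.
   Context: A DAG is a finite directed acyclic graph, possibly with multiple edges; sources have no incoming edges, sinks no outgoing edges, other vertices are inner; $\mathrm{in}(v),\mathrm{out}(v)$ are incoming/outgoing edges. $G$ is full if every inner vertex $v$ has $|\mathrm{in}(v)|=|\mathrm{out}(v)|=2$. A route is a maximal directed path (source to sink). A framing assigns to each inner vertex $v$ linear orders $\prec$ on $\mathrm{in}(v)$ and $\mathrm{out}(v)$. For inner $v$, paths in $\mathrm{Out}(v)$ (from $v$ to a sink) are compared by $P\prec Q$ iff at the last vertex $w$ of their common initial segment the edge of $P$ leaving $w$ precedes that of $Q$ in $\mathrm{out}(w)$; analogously for $\mathrm{In}(v)$ (paths from a source to $v$) at the first vertex of their common final segment using $\mathrm{in}(w)$. For a route $R$ through $v$, $Rv$, $vR$ are its parts before/after $v$. Routes $P,Q$ through a common inner vertex $v$ conflict at $v$ if, after possibly swapping them, $Pv\prec Qv$ and $vQ\prec vP$; coherent if no conflict at any common inner vertex. A route is exceptional if coherent with all routes. With $\mathcal{F}_+(G)\subset\mathbb{R}^{E(G)}$ the cone of nonnegative flows (conservation at inner vertices) and $v_R$ the indicator vector of $R$, a framing is ample if $\{v_R:R\text{ exceptional}\}$ lies in no facet of $\mathcal{F}_+(G)$ (equivalently, every non-idle edge lies on an exceptional route; an edge is idle if it is the only incoming or only outgoing edge of an inner vertex). *)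

theory Defs
  imports "HOL-Analysis.Analysis" "Graph_Theory.Graph_Theory"
begin

text \<open>Multiple arcs are allowed by \<^locale>\<open>fin_digraph\<close>; loops are cycles, hence excluded.\<close>

locale dag = fin_digraph G for G :: "('v, 'e) pre_digraph" (structure) +
  assumes acyclic: "\<not> cycle p"

definition source :: "('v, 'e) pre_digraph \<Rightarrow> 'v \<Rightarrow> bool" where
  "source G v \<longleftrightarrow> v \<in> verts G \<and> in_arcs G v = {}"

definition sink :: "('v, 'e) pre_digraph \<Rightarrow> 'v \<Rightarrow> bool" where
  "sink G v \<longleftrightarrow> v \<in> verts G \<and> out_arcs G v = {}"

definition inner_vert :: "('v, 'e) pre_digraph \<Rightarrow> 'v \<Rightarrow> bool" where
  "inner_vert G v \<longleftrightarrow> v \<in> verts G \<and> \<not> source G v \<and> \<not> sink G v"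

definition full :: "('v, 'e) pre_digraph \<Rightarrow> bool" where
  "full G \<longleftrightarrow> (\<forall>v. inner_vert G v \<longrightarrow> card (in_arcs G v) = 2 \<and> card (out_arcs G v) = 2)"

text \<open>
  Paths are given by their lists of arcs. In an acyclic graph every arc walk is a path.
  The empty list is a route only for an isolated vertex, which is both a source and a sink.
\<close>

definition in_paths :: "('v, 'e) pre_digraph \<Rightarrow> 'v \<Rightarrow> 'e awalk set" where
  "in_paths G v = {p. \<exists>s. source G s \<and> pre_digraph.awalk G s p v}"

definition out_paths :: "('v, 'e) pre_digraph \<Rightarrow> 'v \<Rightarrow> 'e awalk set" where
  "out_paths G v = {p. \<exists>t. sink G t \<and> pre_digraph.awalk G v p t}"

definition routes :: "('v, 'e) pre_digraph \<Rightarrow> 'e awalk set" where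
  "routes G = {p. \<exists>s t. source G s \<and> sink G t \<and> pre_digraph.awalk G s p t}"

text \<open>The values of the two order fields at vertices that are not inner are irrelevant.\<close>

record ('v, 'e) framing =
  in_ord :: "'v \<Rightarrow> 'e rel"
  out_ord :: "'v \<Rightarrow> 'e rel"

definition is_framing :: "('v, 'e) pre_digraph \<Rightarrow> ('v, 'e) framing \<Rightarrow> bool" where
  "is_framing G F \<longleftrightarrow> (\<forall>v. inner_vert G v \<longrightarrow>
     in_ord F v \<subseteq> in_arcs G v \<times> in_arcs G v \<and>
     strict_linear_order_on (in_arcs G v) (in_ord F v) \<and>
     out_ord F v \<subseteq> out_arcs G v \<times> out_arcs G v \<and>
     strict_linear_order_on (out_arcs G v) (out_ord F v))"

text \<open>
  In the next two definitions \<open>r\<close> is the maximal common (initial or final) segment of the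
  two paths and \<open>w\<close> is the vertex at which they diverge, resp. merge.
\<close>

definition out_less ::
    "('v, 'e) pre_digraph \<Rightarrow> ('v, 'e) framing \<Rightarrow> 'v \<Rightarrow> 'e awalk \<Rightarrow> 'e awalk \<Rightarrow> bool" where
  "out_less G F v p q \<longleftrightarrow> (\<exists>w r a p' b q'.
     p = r @ a # p' \<and> q = r @ b # q' \<and> a \<noteq> b \<and>
     pre_digraph.awalk G v r w \<and> (a, b) \<in> out_ord F w)"

definition in_less ::
    "('v, 'e) pre_digraph \<Rightarrow> ('v, 'e) framing \<Rightarrow> 'v \<Rightarrow> 'e awalk \<Rightarrow> 'e awalk \<Rightarrow> bool" where
  "in_less G F v p q \<longleftrightarrow> (\<exists>w r a p' b q'.
     p = p' @ a # r \<and> q = q' @ b # r \<and> a \<noteq> b \<and>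
     pre_digraph.awalk G w r v \<and> (a, b) \<in> in_ord F w)"

text \<open>
  A route through \<open>v\<close> splits uniquely into its part before and its part after \<open>v\<close>, so the
  existential quantifiers below just name these parts (and force both routes through \<open>v\<close>).
\<close>

definition conflict_at ::
    "('v, 'e) pre_digraph \<Rightarrow> ('v, 'e) framing \<Rightarrow> 'v \<Rightarrow> 'e awalk \<Rightarrow> 'e awalk \<Rightarrow> bool" where
  "conflict_at G F v P Q \<longleftrightarrow>
     (\<exists>Pv\<in>in_paths G v. \<exists>vP\<in>out_paths G v. \<exists>Qv\<in>in_paths G v. \<exists>vQ\<in>out_paths G v.
        P = Pv @ vP \<and> Q = Qv @ vQ \<and>
        (in_less G F v Pv Qv \<and> out_less G F v vQ vP \<or>
         in_less G F v Qv Pv \<and> out_less G F v vP vQ))"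

definition coherent ::
    "('v, 'e) pre_digraph \<Rightarrow> ('v, 'e) framing \<Rightarrow> 'e awalk \<Rightarrow> 'e awalk \<Rightarrow> bool" where
  "coherent G F P Q \<longleftrightarrow> (\<forall>v. inner_vert G v \<longrightarrow> \<not> conflict_at G F v P Q)"

definition exceptional_routes ::
    "('v, 'e) pre_digraph \<Rightarrow> ('v, 'e) framing \<Rightarrow> 'e awalk set" where
  "exceptional_routes G F = {R \<in> routes G. \<forall>Q\<in>routes G. coherent G F R Q}"

text \<open>
  The space of real functions on the arc set is realised as the coordinate subspace of
  \<^typ>\<open>real ^ 'e\<close> of the vectors vanishing outside \<^term>\<open>arcs G\<close>. Being a facet does not
  depend on the ambient space.
\<close>

definition flow_cone :: "('v, 'e::finite) pre_digraph \<Rightarrow> (real ^ 'e) set" where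
  "flow_cone G = {x. (\<forall>e. e \<notin> arcs G \<longrightarrow> x $ e = 0) \<and> (\<forall>e\<in>arcs G. 0 \<le> x $ e) \<and>
     (\<forall>v. inner_vert G v \<longrightarrow> (\<Sum>e\<in>in_arcs G v. x $ e) = (\<Sum>e\<in>out_arcs G v. x $ e))}"

definition route_vec :: "'e::finite awalk \<Rightarrow> real ^ 'e" where
  "route_vec R = (\<chi> e. if e \<in> set R then 1 else 0)"

definition ample :: "('v, 'e::finite) pre_digraph \<Rightarrow> ('v, 'e) framing \<Rightarrow> bool" where
  "ample G F \<longleftrightarrow> \<not> (\<exists>S. S facet_of flow_cone G \<and> route_vec ` exceptional_routes G F \<subseteq> S)"

end

theory Submission
  imports Defs
begin

text \<open>
  Colour the arcs with two colours so that at each inner vertex the two incoming arcs get different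
  colours, and so do the two outgoing arcs. Such a colouring exists: the two kinds of constraints
  are two partial matchings on the arcs, whose union consists of paths and even cycles.
  Frame each vertex by letting the colour \<^term>\<open>False\<close> precede \<^term>\<open>True\<close>. A conflict at a vertex
  forces both routes to use both colours, so monochromatic routes are exceptional. Every arc extends
  to a monochromatic route, hence the exceptional routes average to a point of the flow cone that is
  positive on all arcs; such a point is in no proper face.
\<close>

section \<open>Colouring a union of two matchings\<close>

text \<open>Partial matchings are encoded as involutions; the fixed points are the unmatched elements.\<close>

lemma involution_Diff:
  assumes f: "\<forall>x\<in>E. f x \<in> E \<and> f (f x) = x" and a: "a \<in> E"
  shows "\<forall>x\<in>E - {a, f a}. f x \<in> E - {a, f a} \<and> f (f x) = x"
proof
  fix x assume x: "x \<in> E - {a, f a}"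
  then have "f x \<noteq> a" "f x \<noteq> f a"
    using f a by (metis DiffD1 DiffD2 insertI1 insertI2)+
  then show "f x \<in> E - {a, f a} \<and> f (f x) = x" using x f by blast
qed

text \<open>Induction on the size of \<open>E\<close> replaces a decomposition into paths and
  cycles. An element left free by one matching is deleted and coloured last. If there is none, an
  \<open>f\<close>-edge is removed, which deletes a cycle of length two or shortens a longer one by
  two, so parity is kept.\<close>

lemma two_involutions_bicolouring:
  fixes f g :: "'a \<Rightarrow> 'a"
  assumes "finite E"
    and "\<forall>x\<in>E. f x \<in> E \<and> f (f x) = x"
    and "\<forall>x\<in>E. g x \<in> E \<and> g (g x) = x"
  shows "\<exists>c :: 'a \<Rightarrow> bool. \<forall>x\<in>E. (f x \<noteq> x \<longrightarrow> c (f x) \<noteq> c x) \<and> (g x \<noteq> x \<longrightarrow> c (g x) \<noteq> c x)"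
  using assms
proof (induction "card E" arbitrary: E f g rule: less_induct)
  case less
  \<comment> \<open>Stated for arbitrary \<open>f\<close> and \<open>g\<close> so that the two
    matchings can exchange roles.\<close>
  have unmatched: "\<exists>c :: 'a \<Rightarrow> bool. \<forall>x\<in>E. (f x \<noteq> x \<longrightarrow> c (f x) \<noteq> c x) \<and> (g x \<noteq> x \<longrightarrow> c (g x) \<noteq> c x)"
    if f: "\<forall>x\<in>E. f x \<in> E \<and> f (f x) = x" and g: "\<forall>x\<in>E. g x \<in> E \<and> g (g x) = x"
      and a: "a \<in> E" "f a = a" for f g a
  proof -
    \<comment> \<open>Removing \<open>a\<close> leaves its partner \<open>g a\<close> free, so
      \<open>?g\<close> fixes it.\<close>
    let ?E = "E - {a}" and ?g = "g(g a := g a)"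
    have "card ?E < card E"
      using a less.prems(1) by (rule_tac card_Diff1_less)
    moreover have "\<forall>x\<in>?E. f x \<in> ?E \<and> f (f x) = x"
      using f a by (metis Diff_iff singletonD singletonI)
    moreover have "\<forall>x\<in>?E. ?g x \<in> ?E \<and> ?g (?g x) = x"
    proof
      fix x assume x: "x \<in> ?E"
      show "?g x \<in> ?E \<and> ?g (?g x) = x"
      proof (cases "x = g a")
        case True
        then show ?thesis using x by simp
      next
        case False
        then have "g x \<noteq> a" "g x \<noteq> g a" using g a x by (metis DiffD1, metis DiffD1 DiffD2 singletonI)
        then show ?thesis using g x False by auto
      qed
    qed
    ultimately obtain c :: "'a \<Rightarrow> bool" where
      c: "\<forall>x\<in>?E. (f x \<noteq> x \<longrightarrow> c (f x) \<noteq> c x) \<and> (?g x \<noteq> x \<longrightarrow> c (?g x) \<noteq> c x)"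
      using less.hyps[of ?E f ?g] less.prems(1) by blast
    \<comment> \<open>Only its \<open>g\<close>-edge, if any, constrains \<open>a\<close>.\<close>
    let ?c = "c(a := \<not> c (g a))"
    have "(f x \<noteq> x \<longrightarrow> ?c (f x) \<noteq> ?c x) \<and> (g x \<noteq> x \<longrightarrow> ?c (g x) \<noteq> ?c x)" if x: "x \<in> E" for x
    proof -
      consider "x = a" | "x = g a" "x \<noteq> a" | "x \<noteq> g a" "x \<noteq> a" by blast
      then show ?thesis
      proof cases
        case 1
        then show ?thesis using a by simp
      next
        case 2
        then have "g x = a" "f x \<noteq> a" using f g a x by metis+
        then show ?thesis using 2 c x by auto
      next
        case 3
        then have "g x \<noteq> a" "f x \<noteq> a" using f g a x by metis+
        then show ?thesis using 3 bspec[OF c, of x] x by auto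
      qed
    qed
    then show ?thesis by blast
  qed
  show ?case
  proof (cases "\<exists>a\<in>E. f a = a \<or> g a = a")
    case True
    then obtain a where a: "a \<in> E" and "f a = a \<or> g a = a" by blast
    from this(2) show ?thesis
    proof
      assume "f a = a"
      then show ?thesis by (rule unmatched[OF less.prems(2,3) a])
    next
      assume "g a = a"
      from unmatched[OF less.prems(3,2) a this] show ?thesis by blast
    qed
  next
    case no_fix: False
    show ?thesis
    proof (cases "E = {}")
      case True
      then show ?thesis by simp
    next
      case False
      then obtain a where a: "a \<in> E" by blast
      define b where "b = f a"
      have b: "b \<in> E" "b \<noteq> a" "f b = a"
        using a less.prems no_fix by (auto simp: b_def)
      let ?E = "E - {a, b}"
      have card: "card ?E < card E"
        using a less.prems(1) by (intro psubset_card_mono) auto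
      have f': "\<forall>x\<in>?E. f x \<in> ?E \<and> f (f x) = x"
        using involution_Diff[OF less.prems(2) a] by (simp add: b_def)
      show ?thesis
      proof (cases "g a = b")
        case True
        then have g': "\<forall>x\<in>?E. g x \<in> ?E \<and> g (g x) = x"
          using involution_Diff[OF less.prems(3) a] by simp
        obtain c :: "'a \<Rightarrow> bool" where
          c: "\<forall>x\<in>?E. (f x \<noteq> x \<longrightarrow> c (f x) \<noteq> c x) \<and> (g x \<noteq> x \<longrightarrow> c (g x) \<noteq> c x)"
          using less.hyps[OF card finite_Diff[OF less.prems(1)] f' g'] by blast
        have gb: "g b = a" using True a less.prems(3) by metis
        \<comment> \<open>Here \<open>{a, b}\<close> is a component of its own, so any two different
          colours work.\<close>
        let ?c = "c(a := True, b := False)"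
        have "(f x \<noteq> x \<longrightarrow> ?c (f x) \<noteq> ?c x) \<and> (g x \<noteq> x \<longrightarrow> ?c (g x) \<noteq> ?c x)" if x: "x \<in> E" for x
        proof (cases "x \<in> {a, b}")
          case True
          then show ?thesis using \<open>g a = b\<close> gb b b_def by auto
        next
          case False
          then have "f x \<notin> {a, b}" "g x \<notin> {a, b}"
            using x f' g' by blast+
          then show ?thesis using False x c by auto
        qed
        then show ?thesis by blast
      next
        case False
        define a' b' where "a' = g a" and "b' = g b"
        have a': "a' \<in> ?E" "g a' = a" and b': "b' \<in> ?E" "g b' = b" and "a' \<noteq> b'"
          using False a b less.prems(3) no_fix unfolding a'_def b'_def by (auto, metis+)
        \<comment> \<open>Contract the path \<open>a', a, b, b'\<close> to a single matching edge between \<open>a'\<close> and \<open>b'\<close>.\<close>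
        let ?g = "g(a' := b', b' := a')"
        have g_out: "g x \<in> ?E - {a', b'}" if "x \<in> ?E - {a', b'}" for x
          using that involution_Diff[OF less.prems(3) a] involution_Diff[OF less.prems(3) b(1)]
          unfolding a'_def b'_def by blast
        have g': "\<forall>x\<in>?E. ?g x \<in> ?E \<and> ?g (?g x) = x"
        proof
          fix x assume x: "x \<in> ?E"
          show "?g x \<in> ?E \<and> ?g (?g x) = x"
          proof (cases "x \<in> {a', b'}")
            case True
            then show ?thesis using a' b' \<open>a' \<noteq> b'\<close> by auto
          next
            case False
            then have "g x \<in> ?E - {a', b'}" "g (g x) = x"
              using x g_out less.prems(3) by blast+
            then show ?thesis using False by auto
          qed
        qed
        obtain c :: "'a \<Rightarrow> bool" where
          c: "\<forall>x\<in>?E. (f x \<noteq> x \<longrightarrow> c (f x) \<noteq> c x) \<and> (?g x \<noteq> x \<longrightarrow> c (?g x) \<noteq> c x)"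
          using less.hyps[OF card finite_Diff[OF less.prems(1)] f' g'] by blast
        have c_ab: "c a' \<noteq> c b'"
          using bspec[OF c a'(1)] \<open>a' \<noteq> b'\<close> by auto
        \<comment> \<open>\<open>a\<close> and \<open>b\<close> avoid the colours of their
          \<open>g\<close>-partners. The contracted edge makes those colours differ, hence also the
          new ones, as the \<open>f\<close>-edge between \<open>a\<close> and \<open>b\<close>
          demands.\<close>
        let ?c = "c(a := \<not> c a', b := \<not> c b')"
        have "(f x \<noteq> x \<longrightarrow> ?c (f x) \<noteq> ?c x) \<and> (g x \<noteq> x \<longrightarrow> ?c (g x) \<noteq> ?c x)" if x: "x \<in> E" for x
        proof -
          consider "x = a" | "x = b" | "x \<in> {a', b'}" | "x \<in> ?E - {a', b'}"
            using x by blast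
          then show ?thesis
          proof cases
            case 1
            then show ?thesis using a' b c_ab b_def a'_def by auto
          next
            case 2
            then show ?thesis using b' b c_ab b'_def by auto
          next
            case 3
            then have "x \<in> ?E" using a' b' by blast
            then have "f x \<in> ?E" "f x \<noteq> x \<longrightarrow> c (f x) \<noteq> c x" using f' c by blast+
            then show ?thesis using 3 a' b' b(2) \<open>x \<in> ?E\<close> by auto
          next
            case 4
            then have "f x \<in> ?E" "g x \<in> ?E" using f' g_out by blast+
            then show ?thesis using 4 bspec[OF c, of x] by auto
          qed
        qed
        then show ?thesis by blast
      qed
    qed
  qed
qed

text \<open>The involution exchanges the two elements of each fibre selected by \<open>P\<close> and
  fixes everything else.\<close>

lemma fibre_swapping_involution:
  assumes "\<And>v. P v \<Longrightarrow> card {e\<in>E. h e = v} = 2"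
  shows "\<exists>f. (\<forall>x\<in>E. f x \<in> E \<and> f (f x) = x) \<and>
    (\<forall>x\<in>E. \<forall>y\<in>E. P (h x) \<and> h x = h y \<and> x \<noteq> y \<longrightarrow> f x = y)"
proof -
  define f where "f x = (if P (h x) then THE y. y \<in> E \<and> h y = h x \<and> y \<noteq> x else x)" for x
  have fibre: "\<exists>y. y \<noteq> x \<and> {e\<in>E. h e = h x} = {x, y}" if x: "x \<in> E" "P (h x)" for x
  proof -
    obtain y z where "{e\<in>E. h e = h x} = {y, z}" "y \<noteq> z"
      using assms[OF x(2)] by (auto simp: card_2_iff)
    moreover from this have "x = y \<or> x = z" using x(1) by blast
    ultimately show ?thesis by (metis insert_commute)
  qed
  have f_eq: "f x = y" if "x \<in> E" "y \<in> E" "P (h x)" "h x = h y" "x \<noteq> y" for x y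
  proof -
    obtain z where z: "{e\<in>E. h e = h x} = {x, z}"
      using fibre[OF \<open>x \<in> E\<close> \<open>P (h x)\<close>] by blast
    have eq_z: "y' = z" if "y' \<in> E" "h y' = h x" "y' \<noteq> x" for y'
    proof -
      have "y' \<in> {x, z}" unfolding z[symmetric] using that by simp
      then show ?thesis using that by simp
    qed
    have "y = z" using that by (intro eq_z) simp_all
    then have "(THE y. y \<in> E \<and> h y = h x \<and> y \<noteq> x) = y"
      using that eq_z by (intro the_equality conjI) (simp_all, blast)
    then show ?thesis
      using \<open>P (h x)\<close> by (simp add: f_def)
  qed
  have "f x \<in> E \<and> f (f x) = x" if x: "x \<in> E" for x
  proof (cases "P (h x)")
    case True
    then obtain y where y: "y \<in> E" "h y = h x" "y \<noteq> x"
      using fibre[OF x] by blast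
    have "f x = y" by (rule f_eq) (use x y True in simp_all)
    moreover have "f y = x" by (rule f_eq) (use x y True in simp_all)
    ultimately show ?thesis using y by simp
  qed (use x in \<open>simp add: f_def\<close>)
  then show ?thesis using f_eq by blast
qed

text \<open>Distinct elements of a selected fibre are partners in one of the two matchings, so a
  bicolouring separates them. In the application \<open>h\<close> and \<open>t\<close> are the head
  and tail maps and \<open>P\<close> selects the inner vertices.\<close>

lemma bicolouring_injective_on_fibres:
  assumes "finite E"
    and h: "\<And>v. P v \<Longrightarrow> card {e\<in>E. h e = v} = 2"
    and t: "\<And>v. P v \<Longrightarrow> card {e\<in>E. t e = v} = 2"
  shows "\<exists>c :: 'a \<Rightarrow> bool. \<forall>v. P v \<longrightarrow> inj_on c {e\<in>E. h e = v} \<and> inj_on c {e\<in>E. t e = v}"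
proof -
  obtain f where f: "\<forall>x\<in>E. f x \<in> E \<and> f (f x) = x"
    "\<forall>x\<in>E. \<forall>y\<in>E. P (h x) \<and> h x = h y \<and> x \<noteq> y \<longrightarrow> f x = y"
    using fibre_swapping_involution[OF h] by blast
  obtain g where g: "\<forall>x\<in>E. g x \<in> E \<and> g (g x) = x"
    "\<forall>x\<in>E. \<forall>y\<in>E. P (t x) \<and> t x = t y \<and> x \<noteq> y \<longrightarrow> g x = y"
    using fibre_swapping_involution[OF t] by blast
  obtain c :: "'a \<Rightarrow> bool" where
    c: "\<forall>x\<in>E. (f x \<noteq> x \<longrightarrow> c (f x) \<noteq> c x) \<and> (g x \<noteq> x \<longrightarrow> c (g x) \<noteq> c x)"
    using two_involutions_bicolouring[OF assms(1) f(1) g(1)] by blast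
  have "inj_on c {e\<in>E. h e = v} \<and> inj_on c {e\<in>E. t e = v}" if "P v" for v
    using that c f(2) g(2) unfolding inj_on_def by (smt (verit) mem_Collect_eq)
  then show ?thesis by blast
qed

section \<open>Monochromatic routes\<close>

text \<open>Sources and sinks are left out because they may carry more than two arcs, which two
  colours cannot separate.\<close>

definition proper_colouring :: "('v, 'e) pre_digraph \<Rightarrow> ('e \<Rightarrow> bool) \<Rightarrow> bool" where
  "proper_colouring G c \<longleftrightarrow> (\<forall>v. inner_vert G v \<longrightarrow> inj_on c (in_arcs G v) \<and> inj_on c (out_arcs G v))"

definition colour_framing :: "('v, 'e) pre_digraph \<Rightarrow> ('e \<Rightarrow> bool) \<Rightarrow> ('v, 'e) framing" where
  "colour_framing G c =
    \<lparr>in_ord = \<lambda>v. {(a, b). a \<in> in_arcs G v \<and> b \<in> in_arcs G v \<and> c a < c b},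
     out_ord = \<lambda>v. {(a, b). a \<in> out_arcs G v \<and> b \<in> out_arcs G v \<and> c a < c b}\<rparr>"

lemma full_imp_proper_colouring:
  assumes "fin_digraph G" "full G"
  shows "\<exists>c. proper_colouring G c"
  unfolding proper_colouring_def in_arcs_def out_arcs_def
  using assms(2)
  by (intro bicolouring_injective_on_fibres fin_digraph.finite_arcs[OF assms(1)])
    (auto simp: full_def in_arcs_def out_arcs_def)

lemma strict_linear_order_on_inj:
  fixes c :: "'a \<Rightarrow> 'b::linorder"
  assumes "inj_on c A"
  shows "strict_linear_order_on A {(a, b). a \<in> A \<and> b \<in> A \<and> c a < c b}"
  using assms
  by (auto simp: strict_linear_order_on_def trans_def irrefl_def total_on_def inj_on_def
      not_less order.order_iff_strict)

lemma is_framing_colour_framing: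
  assumes "proper_colouring G c"
  shows "is_framing G (colour_framing G c)"
  unfolding is_framing_def colour_framing_def framing.simps
  using assms strict_linear_order_on_inj[of c]
  by (intro allI impI conjI) (auto simp: proper_colouring_def simp del: in_in_arcs_conv in_out_arcs_conv)

text \<open>The two arcs at which the paths merge serve as \<open>a\<close> and \<open>b\<close>. As
  \<open>c a < c b\<close> means that \<open>a\<close> has colour \<open>False\<close> and
  \<open>b\<close> has colour \<open>True\<close>, this records a colour used by each path.\<close>

lemma in_less_colour_framing:
  assumes "in_less G (colour_framing G c) v p q"
  shows "\<exists>a\<in>set p. \<exists>b\<in>set q. c a < c b"
  using assms by (auto simp: in_less_def colour_framing_def)

lemma out_less_colour_framing:
  assumes "out_less G (colour_framing G c) v p q"
  shows "\<exists>a\<in>set p. \<exists>b\<in>set q. c a < c b"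
  using assms by (auto simp: out_less_def colour_framing_def)

text \<open>In a conflict at \<open>v\<close>, the part of \<open>R\<close> on one side of
  \<open>v\<close> is the smaller one and contains an arc coloured \<open>False\<close>; on the
  other side it is the larger one and contains an arc coloured \<open>True\<close>.\<close>

lemma monochromatic_route_exceptional:
  assumes "R \<in> routes G" and "\<forall>a\<in>set R. c a = k"
  shows "R \<in> exceptional_routes G (colour_framing G c)"
proof -
  have "\<not> conflict_at G (colour_framing G c) v R Q" for v Q
    using assms(2)
    by (auto simp: conflict_at_def dest!: in_less_colour_framing out_less_colour_framing)
  then show ?thesis
    using assms(1) by (simp add: exceptional_routes_def coherent_def)
qed

context dag
begin

text \<open>A repeated vertex would cut out a closed walk and hence a cycle.\<close>

lemma distinct_awalk:
  assumes "awalk u p v"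
  shows "distinct p"
proof (rule distinct_verts_imp_distinct[OF assms], rule ccontr)
  assume "\<not> distinct (awalk_verts u p)"
  from awalk_cyc_decompE'[OF assms this] obtain r where "closed_w r" by blast
  then show False using closed_w_imp_cycle acyclic by blast
qed

text \<open>This bound allows a longest walk to be chosen.\<close>

lemma length_awalk_le:
  assumes "awalk u p v"
  shows "length p \<le> card (arcs G)"
  using assms distinct_card[OF distinct_awalk[OF assms]] finite_arcs
  by (metis awalk_def card_mono)

text \<open>A longest monochromatic walk through \<open>e\<close> must run from a source to a sink:
  at an inner end vertex both colours are available, so the walk could be extended.\<close>

lemma exists_monochromatic_route:
  assumes "full G" and c: "proper_colouring G c" and e: "e \<in> arcs G"
  shows "\<exists>R\<in>routes G. e \<in> set R \<and> (\<forall>a\<in>set R. c a = c e)"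
proof -
  \<comment> \<open>An injective map from a two-element set to \<open>bool\<close> is onto.\<close>
  have colours: "\<exists>a\<in>A. c a = k" if "card A = 2" "inj_on c A" for A k
  proof -
    have "card (c ` A) = card (UNIV :: bool set)" using that by (simp add: card_image)
    then have "c ` A = UNIV" by (intro card_subset_eq) auto
    then show ?thesis by (metis UNIV_I imageE)
  qed
  define k where "k = c e"
  define mono where "mono p \<longleftrightarrow> e \<in> set p \<and> (\<forall>a\<in>set p. c a = k) \<and> (\<exists>u v. awalk u p v)" for p
  have "mono [e]"
    using e by (auto simp: mono_def k_def awalk_simps)
  moreover have "\<forall>p. mono p \<longrightarrow> length p < Suc (card (arcs G))"
    using length_awalk_le by (auto simp: mono_def less_Suc_eq_le)
  ultimately obtain p where p: "mono p" and max: "\<And>q. mono q \<Longrightarrow> length q \<le> length p"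
    using ex_has_greatest_nat[of mono "[e]" length] by blast
  obtain u v where walk: "awalk u p v" using p by (auto simp: mono_def)
  have "p \<noteq> []" using p by (auto simp: mono_def)
  \<comment> \<open>Since the walk is nonempty, it does not start at a sink or end at a source; only
    inner end vertices remain to be excluded.\<close>
  have "out_arcs G u \<noteq> {}"
    using walk \<open>p \<noteq> []\<close> by (cases p) (auto simp: awalk_Cons_iff)
  moreover have "in_arcs G v \<noteq> {}"
    using walk \<open>p \<noteq> []\<close> by (cases p rule: rev_cases) (auto simp: awalk_Cons_iff awalk_Nil_iff)
  ultimately have ends: "\<not> sink G u" "\<not> source G v" "u \<in> verts G" "v \<in> verts G"
    using walk by (auto simp: sink_def source_def)
  have "source G u"
  proof (rule ccontr)
    assume "\<not> source G u"
    then have "inner_vert G u" using ends by (simp add: inner_vert_def)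
    then obtain a where a: "a \<in> in_arcs G u" "c a = k"
      using colours assms(1) c unfolding full_def proper_colouring_def by metis
    then have "awalk (tail G a) (a # p) v"
      using walk by (simp add: awalk_Cons_iff)
    then have "mono (a # p)"
      using p a unfolding mono_def by auto
    then show False using max by (metis length_Cons Suc_n_not_le_n)
  qed
  moreover have "sink G v"
  proof (rule ccontr)
    assume "\<not> sink G v"
    then have "inner_vert G v" using ends by (simp add: inner_vert_def)
    then obtain a where a: "a \<in> out_arcs G v" "c a = k"
      using colours assms(1) c unfolding full_def proper_colouring_def by metis
    then have "awalk u (p @ [a]) (head G a)"
      by (intro awalk_appendI[OF walk]) (auto simp: awalk_simps)
    then have "\<exists>u v. awalk u (p @ [a]) v" by blast
    then have "mono (p @ [a])"
      using p a by (simp add: mono_def ball_Un del: awalk_append_iff)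
    then show False using max by (metis length_append_singleton Suc_n_not_le_n)
  qed
  ultimately show ?thesis
    using walk p unfolding routes_def mono_def k_def by blast
qed

end

section \<open>Ampleness\<close>

text \<open>From any \<open>y\<close> in the cone, the segment to \<open>x\<close> can be prolonged
  a little beyond \<open>x\<close> within the cone. Then \<open>x\<close> lies strictly between two
  points of the cone, and the face containing \<open>x\<close> contains \<open>y\<close>.\<close>

lemma flow_cone_face_eq:
  fixes G :: "('v, 'e::finite) pre_digraph"
  assumes S: "S face_of flow_cone G" and x: "x \<in> S" "\<forall>e\<in>arcs G. 0 < x $ e"
  shows "S = flow_cone G"
proof
  show "S \<subseteq> flow_cone G" using S by (rule face_of_imp_subset)
  then have xC: "x \<in> flow_cone G" using x(1) by blast
  show "flow_cone G \<subseteq> S"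
  proof
    fix y assume y: "y \<in> flow_cone G"
    show "y \<in> S"
    proof (cases "y = x")
      case False
      \<comment> \<open>Small enough that \<open>d * y $ e\<close> stays below \<open>x $ e\<close>
        on every arc. The summand 1 in the denominator avoids division by zero; the inserted 1 keeps
        the set nonempty when there are no arcs.\<close>
      define d where "d = Min (insert 1 ((\<lambda>e. x $ e / (1 + y $ e)) ` arcs G))"
      have y0: "0 \<le> y $ e" if "e \<in> arcs G" for e
        using y that by (simp add: flow_cone_def)
      have "d > 0"
        unfolding d_def using x(2) y0 by (auto simp: add_pos_nonneg)
      have d: "d * y $ e \<le> x $ e" if e: "e \<in> arcs G" for e
      proof -
        have "d \<le> x $ e / (1 + y $ e)"
          unfolding d_def using e by (intro Min_le) auto
        then have "d * (1 + y $ e) \<le> x $ e"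
          using y0[OF e] by (simp add: pos_le_divide_eq)
        then show ?thesis using \<open>d > 0\<close> by (simp add: distrib_left)
      qed
      \<comment> \<open>The prolonged point. Conservation is linear and carries over; only
        nonnegativity depends on the size of \<open>d\<close>.\<close>
      define z where "z = x + d *\<^sub>R (x - y)"
      have "z \<in> flow_cone G"
        unfolding flow_cone_def
      proof (intro CollectI conjI allI ballI impI)
        fix e assume "e \<notin> arcs G"
        then show "z $ e = 0" using xC y by (simp add: z_def flow_cone_def)
      next
        fix e assume e: "e \<in> arcs G"
        have "z $ e = (x $ e - d * y $ e) + d * x $ e"
          by (simp add: z_def algebra_simps)
        then show "0 \<le> z $ e"
          using d[OF e] x(2) e \<open>d > 0\<close> by (simp add: less_imp_le)
      next
        fix v assume "inner_vert G v"
        then show "(\<Sum>e\<in>in_arcs G v. z $ e) = (\<Sum>e\<in>out_arcs G v. z $ e)"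
          using xC y
          by (simp add: z_def flow_cone_def sum.distrib sum_subtractf flip: sum_distrib_left)
      qed
      moreover have "x \<in> open_segment y z"
      proof -
        \<comment> \<open>This gives the weight \<open>1 / (1 + d)\<close> of \<open>z\<close> in
          the convex combination equal to \<open>x\<close>.\<close>
        have "z - y = (1 + d) *\<^sub>R (x - y)"
          by (simp add: z_def algebra_simps)
        then have "z \<noteq> y" and "x = y + (1 / (1 + d)) *\<^sub>R (z - y)"
          using False \<open>d > 0\<close> by auto
        then have "x = (1 - 1 / (1 + d)) *\<^sub>R y + (1 / (1 + d)) *\<^sub>R z"
          by (simp add: algebra_simps)
        then show ?thesis
          using \<open>z \<noteq> y\<close> \<open>d > 0\<close> unfolding in_segment
          by (intro conjI exI[of _ "1 / (1 + d)"]) auto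
      qed
      ultimately show ?thesis
        using S x(1) y by (auto simp: face_of_def)
    qed (use x in simp)
  qed
qed

text \<open>A facet containing all exceptional route vectors would, by convexity, contain the
  average of one such vector per arc. This average is positive on every arc, so the facet would be
  the whole cone.\<close>

lemma ample_if_arcs_on_exceptional_routes:
  fixes G :: "('v, 'e::finite) pre_digraph"
  assumes "\<And>e. e \<in> arcs G \<Longrightarrow> \<exists>R\<in>exceptional_routes G F. e \<in> set R"
  shows "ample G F"
  unfolding ample_def
proof
  assume "\<exists>S. S facet_of flow_cone G \<and> route_vec ` exceptional_routes G F \<subseteq> S"
  then obtain S where S: "S face_of flow_cone G" "S \<noteq> {}" "S \<noteq> flow_cone G"
    and sub: "route_vec ` exceptional_routes G F \<subseteq> S"
    by (metis facet_of_def facet_of_irrefl)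
  obtain R where R: "\<And>e. e \<in> arcs G \<Longrightarrow> R e \<in> exceptional_routes G F \<and> e \<in> set (R e)"
    using assms by metis
  have "\<exists>x\<in>S. \<forall>e\<in>arcs G. 0 < x $ e"
  proof (cases "arcs G = {}")
    \<comment> \<open>There is nothing to average; any point of \<open>S\<close> is vacuously
      positive.\<close>
    case True
    then show ?thesis using S(2) by auto
  next
    case False
    let ?w = "1 / real (card (arcs G))"
    define x :: "real ^ 'e" where "x = (\<Sum>e\<in>arcs G. ?w *\<^sub>R route_vec (R e))"
    have "x \<in> S"
      unfolding x_def using False R sub face_of_imp_convex[OF S(1)]
      by (intro convex_sum) auto
    moreover have "0 < x $ e" if e: "e \<in> arcs G" for e
    proof -
      have "0 < ?w * route_vec (R e) $ e"
        using R[OF e] False by (simp add: route_vec_def card_gt_0_iff)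
      also have "\<dots> \<le> (\<Sum>e'\<in>arcs G. ?w * route_vec (R e') $ e)"
        using e by (intro member_le_sum) (auto simp: route_vec_def)
      finally show ?thesis by (simp add: x_def)
    qed
    ultimately show ?thesis by blast
  qed
  then show False using flow_cone_face_eq[OF S(1)] S(3) by blast
qed

theorem theorem3p12:
  fixes G :: "('v, 'e::finite) pre_digraph"
  assumes "dag G" and "full G"
  shows "\<exists>F. is_framing G F \<and> ample G F"
proof -
  interpret dag G by fact
  obtain c where c: "proper_colouring G c"
    using full_imp_proper_colouring[OF fin_digraph_axioms assms(2)] by blast
  have "ample G (colour_framing G c)"
    using exists_monochromatic_route[OF assms(2) c] monochromatic_route_exceptional
    by (intro ample_if_arcs_on_exceptional_routes) blast
  then show ?thesis using is_framing_colour_framing[OF c] by blast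
qed

end
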